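(* Let $(L,\mathcal G)$ be a nestoid. The rays of the universe fan $\mathcal U_{\mathcal G}$ are (generated by) the vectors $w_R$ for $R$ ranging over the causal regions in $\mathcal G$. The maximal cones of $\mathcal U_{\mathcal G}$ are the cones $U_N$ for $N\in\mathcal N(L,\mathcal G)$ a maximal nested set, and for such $N$ $$U_N=\mathrm{Span}_{\mathbb R_+}\bigl(w_R \mid R\subseteq N \text{ a causal region}\bigr).$$
   Context: All lattices are finite. Let $L$ be a lattice with minimum $\hat 0$ and maximum $\hat 1$. A subset $\mathcal G\subseteq L_{>\hat 0}$ is nestable if $\hat 1\in\mathcal G$ and for any two incomparable $f,g\in\mathcal G$, $f\vee g\notin\mathcal G$ implies $f\wedge g=\hat 0$. A subset $N\subseteq\mathcal G$ is nested if for all $k\ge 2$ and pairwise incomparable $f_1,\dots,f_k\in N$ one has $f_1\vee\dots\vee f_k\notin\mathcal G$. $\mathcal N(L,\mathcal G)$ is the simplicial complex of nested sets. $(L,\mathcal G)$ is a nestoid if $\mathcal G$ is nestable and for every $f\in\mathcal G$ the complex $\mathcal N([\hat 0,f],\mathcal G\cap[\hat 0,f])$ is pure. $\mathbb R^{2\mathcal G}$ is the real vector space with basis $f^+,f^-$ ($f\in\mathcal G$); $p_f,m_f$ are the dual coordinates. For a nested set $N$, $\mathbb R_+^{2N}$ is the cone spanned by $f^+,f^-$, $f\in N$. The doubled free nested set fan $\Sigma^{2\mathcal G}$ consists of all faces of the cones $\mathbb R_+^{2N}$, $N\in\mathcal N(L,\mathcal G)$. For $g\in\mathcal G$ put $$F_g:=p_{\hat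 1}+\sum_{f\in\mathcal G,\ g<f<\hat 1}(p_f-m_f)-m_g .$$ The causal cone is $\{m_{\hat 1}=0,\ p_g\ge0,\ m_g\ge0,\ F_g\ge 0\ \text{for all } g\in\mathcal G\}\subseteq\mathbb R^{2\mathcal G}$. The universe fan $\mathcal U_{\mathcal G}$ is obtained by intersecting the cones of $\Sigma^{2\mathcal G}$ with the causal cone (its cones are these intersections and all their faces). $U_N$ is the intersection of $\mathbb R_+^{2N}$ with the causal cone. A causal region in $\mathcal G$ is a nested set $R=\{r_*,r_1,\dots,r_k\}$ ($k\ge 0$) with a unique maximal element $r_*$ and with $r_1,\dots,r_k$ pairwise incomparable; $w_R:=r_*^++\sum_{i=1}^k r_i^-$. *)

theory Defs
  imports "HOL-Analysis.Analysis"
begin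

text \<open>A finite lattice is a type of class \<open>{finite, bounded_lattice}\<close>, with
  minimum \<open>bot\<close> and maximum \<open>top\<close>.\<close>

subsection \<open>Nestoids\<close>

definition incomparable :: "'a::order \<Rightarrow> 'a \<Rightarrow> bool" where
  "incomparable f g \<longleftrightarrow> \<not> f \<le> g \<and> \<not> g \<le> f"

definition nestable :: "'a::bounded_lattice set \<Rightarrow> bool" where
  "nestable G \<longleftrightarrow>
     G \<subseteq> {x. bot < x} \<and> top \<in> G \<and>
     (\<forall>f\<in>G. \<forall>g\<in>G. incomparable f g \<longrightarrow> sup f g \<notin> G \<longrightarrow> inf f g = bot)"

definition nested :: "'a::{finite, bounded_lattice} set \<Rightarrow> 'a set \<Rightarrow> bool" where
  "nested G N \<longleftrightarrow>
     N \<subseteq> G \<and>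
     (\<forall>A\<subseteq>N. 2 \<le> card A \<longrightarrow> pairwise incomparable A \<longrightarrow> Sup_fin A \<notin> G)"

definition nested_complex :: "'a::{finite, bounded_lattice} set \<Rightarrow> 'a set set" where
  "nested_complex G = {N. nested G N}"

definition maximal_members :: "'b set set \<Rightarrow> 'b set set" where
  "maximal_members K = {M \<in> K. \<forall>M'\<in>K. M \<subseteq> M' \<longrightarrow> M' = M}"

definition pure_complex :: "'b set set \<Rightarrow> bool" where
  "pure_complex K \<longleftrightarrow>
     (\<forall>M\<in>maximal_members K. \<forall>M'\<in>maximal_members K. card M = card M')"

text \<open>Joins in an interval \<open>{bot..f}\<close> agree with joins in the whole lattice, so
  the nested set complex of the lattice \<open>{bot..f}\<close> with respect to
  \<open>G \<inter> {bot..f}\<close> can be computed with the ambient join.\<close>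

definition nestoid :: "'a::{finite, bounded_lattice} set \<Rightarrow> bool" where
  "nestoid G \<longleftrightarrow>
     nestable G \<and> (\<forall>f\<in>G. pure_complex (nested_complex (G \<inter> {bot..f})))"

subsection \<open>The doubled free nested set fan\<close>

text \<open>A vector is a pair \<open>(p, m)\<close>, where \<open>p $ f\<close> and \<open>m $ f\<close> are its coordinates along
  \<open>f\<^sup>+\<close> and \<open>f\<^sup>-\<close>. As \<open>G\<close> is a set of lattice elements and not a type, the space
  with basis \<open>f\<^sup>+, f\<^sup>-\<close> for \<open>f \<in> G\<close> is the coordinate subspace \<open>doubled_space G\<close>.\<close>

type_synonym 'a doubled = "(real ^ 'a) \<times> (real ^ 'a)"

definition coord_p :: "'a::finite \<Rightarrow> 'a doubled \<Rightarrow> real" where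
  "coord_p f x = fst x $ f"

definition coord_m :: "'a::finite \<Rightarrow> 'a doubled \<Rightarrow> real" where
  "coord_m f x = snd x $ f"

definition basis_plus :: "'a::finite \<Rightarrow> 'a doubled" where
  "basis_plus f = (axis f 1, 0)"

definition basis_minus :: "'a::finite \<Rightarrow> 'a doubled" where
  "basis_minus f = (0, axis f 1)"

definition doubled_space :: "'a::finite set \<Rightarrow> 'a doubled set" where
  "doubled_space G = span (basis_plus ` G \<union> basis_minus ` G)"

definition orthant :: "'a::finite set \<Rightarrow> 'a doubled set" where
  "orthant N = convex_cone hull (basis_plus ` N \<union> basis_minus ` N)"

text \<open>The library counts the empty set as a face of every convex set; a face of a
  cone is nonempty.\<close>

definition cone_faces :: "'b::real_vector set \<Rightarrow> 'b set set" where
  "cone_faces C = {F. F face_of C \<and> F \<noteq> {}}"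

definition doubled_fan :: "'a::{finite, bounded_lattice} set \<Rightarrow> 'a doubled set set" where
  "doubled_fan G = (\<Union>N\<in>nested_complex G. cone_faces (orthant N))"

subsection \<open>The universe fan\<close>

definition causal_form ::
    "'a::{finite, bounded_lattice} set \<Rightarrow> 'a \<Rightarrow> 'a doubled \<Rightarrow> real" where
  "causal_form G g x =
     coord_p top x
     + (\<Sum>f\<in>{f\<in>G. g < f \<and> f < top}. coord_p f x - coord_m f x)
     - coord_m g x"

definition causal_cone :: "'a::{finite, bounded_lattice} set \<Rightarrow> 'a doubled set" where
  "causal_cone G =
     {x \<in> doubled_space G.
        coord_m top x = 0 \<and>
        (\<forall>g\<in>G. 0 \<le> coord_p g x \<and> 0 \<le> coord_m g x \<and> 0 \<le> causal_form G g x)}"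

text \<open>Each intersection is a face of itself.\<close>

definition universe_fan :: "'a::{finite, bounded_lattice} set \<Rightarrow> 'a doubled set set" where
  "universe_fan G = (\<Union>C\<in>doubled_fan G. cone_faces (C \<inter> causal_cone G))"

definition universe_cone ::
    "'a::{finite, bounded_lattice} set \<Rightarrow> 'a set \<Rightarrow> 'a doubled set" where
  "universe_cone G N = orthant N \<inter> causal_cone G"

definition fan_rays :: "'b::euclidean_space set set \<Rightarrow> 'b set set" where
  "fan_rays \<Sigma> = {C \<in> \<Sigma>. dim C = 1}"

subsection \<open>Causal regions\<close>

definition maximal_in :: "'a::order set \<Rightarrow> 'a \<Rightarrow> bool" where
  "maximal_in R r \<longleftrightarrow> r \<in> R \<and> (\<forall>s\<in>R. \<not> r < s)"

text \<open>The element \<open>r\<^sub>*\<close>; only meaningful if \<open>R\<close> has a unique maximal element.\<close>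

definition region_top :: "'a::order set \<Rightarrow> 'a" where
  "region_top R = (THE r. maximal_in R r)"

definition causal_region :: "'a::{finite, bounded_lattice} set \<Rightarrow> 'a set \<Rightarrow> bool" where
  "causal_region G R \<longleftrightarrow>
     nested G R \<and> (\<exists>!r. maximal_in R r) \<and> pairwise incomparable (R - {region_top R})"

definition region_vector :: "'a::{finite, order} set \<Rightarrow> 'a doubled" where
  "region_vector R =
     basis_plus (region_top R) + (\<Sum>r\<in>R - {region_top R}. basis_minus r)"

end

theory Submission
  imports Defs
begin

text \<open>
  Read a point of the causal cone as mass travelling down the order: \<open>f\<^sup>+\<close> creates mass at
  \<open>f\<close>, visible everywhere strictly below \<open>f\<close>, and \<open>f\<^sup>-\<close> destroys mass there. Writing
  \<open>budget G g x\<close> for the sum of \<open>p\<^sub>f - m\<^sub>f\<close> over \<open>f > g\<close>, the inequalities \<open>F\<^sub>g \<ge> 0\<close> together with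
  the equation for \<open>m\<close> at \<open>top\<close> say that no \<open>m\<^sub>g\<close> exceeds the mass that arrives at \<open>g\<close>.
  A causal region is the life of one particle: it is born at \<open>r\<^sub>*\<close> and dies, at most once
  along each downward path, at the \<open>r\<^sub>i\<close>.

  Nestability makes every nested set \<open>N\<close> a forest: the members above a given element other
  than \<open>bot\<close> form a chain. Hence a particle is alive at \<open>g\<close> with multiplicity zero or one, so
  \<open>w\<^sub>R\<close> is causal. Conversely a point of \<open>U\<^sub>N\<close> splits into particles by induction on \<open>N\<close>,
  removing a minimal \<open>g \<in> N\<close>: the mass \<open>m\<^sub>g\<close> can be charged to regions still alive at \<open>g\<close>,
  and adding \<open>g\<close> to such a region gives a region again; the mass \<open>p\<^sub>g\<close> is a multiple of the
  region \<open>{g}\<close>. So \<open>U\<^sub>N\<close> is generated by the regions inside \<open>N\<close>, for every nested \<open>N\<close>.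

  The statements on the fan follow. Its members are the faces of the \<open>U\<^sub>N\<close>, because cutting
  with a convex set turns faces into faces. The vector \<open>f\<^sup>+\<close> of the region \<open>{f}\<close> lies in \<open>U\<^sub>N\<close>
  exactly when \<open>f \<in> N\<close>, so inclusions among the \<open>U\<^sub>N\<close> reflect those among the \<open>N\<close>. A
  one-dimensional face of a generated cone is spanned by one of the generators. Finally \<open>w\<^sub>R\<close>
  does span a face of \<open>U\<^sub>R\<close>: it is cut out by requiring that nothing is born at an \<open>r\<^sub>i\<close> and
  that everything arriving there dies.
\<close>

section \<open>Generated cones and their faces\<close>

lemma convex_cone_hull_nonzero_split:
  assumes "x \<in> convex_cone hull W" "x \<noteq> 0"
  shows "\<exists>w\<in>W. \<exists>c>0. \<exists>y\<in>convex_cone hull W. x = c *\<^sub>R w + y"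
proof -
  let ?C = "convex_cone hull W"
  let ?T = "{x \<in> ?C. x = 0 \<or> (\<exists>w\<in>W. \<exists>c>0. \<exists>y\<in>?C. x = c *\<^sub>R w + y)}"
  have "convex_cone ?T"
  proof (intro convex_cone_iff[THEN iffD2] conjI ballI allI impI)
    show "0 \<in> ?T" by (simp add: convex_cone_hull_contains_0)
  next
    fix a b assume a: "a \<in> ?T" and b: "b \<in> ?T"
    have ab: "a + b \<in> ?C" using a b by (simp add: convex_cone_hull_add)
    show "a + b \<in> ?T"
    proof (cases "a = 0")
      case True then show ?thesis using b by simp
    next
      case False
      then obtain w c y where "w \<in> W" "c > 0" "y \<in> ?C" "a = c *\<^sub>R w + y" using a by auto
      moreover have "y + b \<in> ?C" using \<open>y \<in> ?C\<close> b by (simp add: convex_cone_hull_add)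
      moreover have "a + b = c *\<^sub>R w + (y + b)" using \<open>a = c *\<^sub>R w + y\<close> by simp
      ultimately show ?thesis using ab by blast
    qed
  next
    fix a and d :: real assume a: "a \<in> ?T" and d: "0 \<le> d"
    have da: "d *\<^sub>R a \<in> ?C" using a d by (simp add: convex_cone_hull_mul)
    show "d *\<^sub>R a \<in> ?T"
    proof (cases "a = 0 \<or> d = 0")
      case True then show ?thesis using da by auto
    next
      case False
      then obtain w c y where w: "w \<in> W" "c > 0" "y \<in> ?C" "a = c *\<^sub>R w + y" using a by auto
      have "d *\<^sub>R y \<in> ?C" using w d by (simp add: convex_cone_hull_mul)
      moreover have "d *\<^sub>R a = (d * c) *\<^sub>R w + d *\<^sub>R y" using w by (simp add: scaleR_add_right)
      moreover have "d * c > 0" using w d False by simp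
      ultimately show ?thesis using da w(1) by blast
    qed
  qed
  moreover have "W \<subseteq> ?T"
  proof
    fix w assume "w \<in> W"
    moreover have "w = 1 *\<^sub>R w + 0" "(0::real) < 1" by auto
    ultimately show "w \<in> ?T"
      using convex_cone_hull_contains_0[of W] hull_inc[of w W convex_cone] by blast
  qed
  ultimately have "?C \<subseteq> ?T" by (simp add: hull_minimal)
  then show ?thesis using assms by auto
qed

text \<open>A point \<open>x = c w + y\<close> of the face is the midpoint of \<open>2 c w\<close> and \<open>2 y\<close>, so the face
  contains \<open>2 c w\<close>, hence the generator \<open>w\<close>.\<close>

lemma face_contains_generator:
  assumes X: "X face_of convex_cone hull W" and x: "x \<in> X" "x \<noteq> 0"
  shows "\<exists>w\<in>W. w \<in> X"
proof -
  let ?C = "convex_cone hull W"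
  have "x \<in> ?C" using X x face_of_imp_subset by blast
  then obtain w c y where w: "w \<in> W" "c > 0" "y \<in> ?C" "x = c *\<^sub>R w + y"
    using convex_cone_hull_nonzero_split x(2) by metis
  define a b where "a = (2 * c) *\<^sub>R w" and "b = 2 *\<^sub>R y"
  have ab: "a \<in> ?C" "b \<in> ?C"
    using w by (auto simp: a_def b_def hull_inc convex_cone_hull_mul)
  have xab: "x = midpoint a b"
    by (simp add: midpoint_def a_def b_def w(4) scaleR_add_right)
  have "a \<in> X"
  proof (cases "a = b")
    case True then show ?thesis using x(1) xab by simp
  next
    case False
    then have "x \<in> open_segment a b" using xab by simp
    then show ?thesis using X ab x(1) by (auto simp: face_of_def)
  qed
  moreover have "conic X" using X face_of_conic conic_convex_cone_hull by blast
  ultimately have "(1 / (2 * c)) *\<^sub>R a \<in> X" using w(2) by (simp add: conic_mul)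
  then show ?thesis using w by (auto simp: a_def)
qed

lemma linear_zero_set_face_of:
  fixes h :: "'b::real_vector \<Rightarrow> real"
  assumes S: "convex S" and h: "linear h" and nonneg: "\<And>x. x \<in> S \<Longrightarrow> 0 \<le> h x"
  shows "{x \<in> S. h x = 0} face_of S"
proof -
  have conv: "convex {x \<in> S. h x = 0}"
    using S unfolding convex_def by (auto simp: linear_add[OF h] linear_cmul[OF h])
  have "a \<in> S \<and> h a = 0 \<and> b \<in> S \<and> h b = 0"
    if ab: "a \<in> S" "b \<in> S" and x: "h x = 0" "x \<in> open_segment a b" for a b x
  proof -
    obtain u where u: "0 < u" "u < 1" "x = (1 - u) *\<^sub>R a + u *\<^sub>R b"
      using x(2) by (auto simp: in_segment)
    then have "(1 - u) * h a + u * h b = 0"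
      using x(1) by (simp add: linear_add[OF h] linear_cmul[OF h])
    moreover have "0 \<le> (1 - u) * h a" "0 \<le> u * h b" using nonneg ab u by auto
    ultimately have "(1 - u) * h a = 0" "u * h b = 0" by linarith+
    then show ?thesis using u ab by auto
  qed
  then show ?thesis unfolding face_of_def using conv by blast
qed

lemma convex_cone_hull_singleton: "convex_cone hull {v} = {c *\<^sub>R v | c. 0 \<le> c}"
  by (simp add: convex_cone_hull_separate_nonempty conic_hull_explicit)

lemma dim_convex_cone_hull_singleton:
  fixes v :: "'b::euclidean_space"
  assumes "v \<noteq> 0"
  shows "dim (convex_cone hull {v}) = 1"
proof -
  have "span (convex_cone hull {v}) = span {v}"
  proof
    show "span (convex_cone hull {v}) \<subseteq> span {v}"
      by (rule span_minimal) (auto simp: convex_cone_hull_singleton span_mul span_base)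
    show "span {v} \<subseteq> span (convex_cone hull {v})" by (simp add: hull_subset span_mono)
  qed
  then have "dim (convex_cone hull {v}) = dim {v}" by (metis dim_span)
  then show ?thesis using assms by (simp add: dim_insert)
qed

section \<open>Coordinates and budgets\<close>

lemma coord_linear [simp]:
  "coord_p f 0 = 0" "coord_m f 0 = 0"
  "coord_p f (x + y) = coord_p f x + coord_p f y"
  "coord_m f (x + y) = coord_m f x + coord_m f y"
  "coord_p f (c *\<^sub>R x) = c * coord_p f x"
  "coord_m f (c *\<^sub>R x) = c * coord_m f x"
  by (auto simp: coord_p_def coord_m_def)

lemma coord_sum [simp]:
  "coord_p f (sum h A) = (\<Sum>a\<in>A. coord_p f (h a))"
  "coord_m f (sum h A) = (\<Sum>a\<in>A. coord_m f (h a))"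
  by (induction A rule: infinite_finite_induct) auto

lemma coord_basis [simp]:
  "coord_p f (basis_plus g) = of_bool (f = g)" "coord_m f (basis_plus g) = 0"
  "coord_p f (basis_minus g) = 0" "coord_m f (basis_minus g) = of_bool (f = g)"
  by (auto simp: coord_p_def coord_m_def basis_plus_def basis_minus_def axis_def)

lemma doubled_eqI:
  assumes "\<And>f. coord_p f x = coord_p f y" "\<And>f. coord_m f x = coord_m f y"
  shows "x = y"
  using assms by (simp add: coord_p_def coord_m_def prod_eq_iff vec_eq_iff)

lemma orthant_iff:
  "x \<in> orthant N \<longleftrightarrow>
     (\<forall>f. 0 \<le> coord_p f x \<and> 0 \<le> coord_m f x \<and> (f \<notin> N \<longrightarrow> coord_p f x = 0 \<and> coord_m f x = 0))"
proof -
  let ?C = "{x. \<forall>f. 0 \<le> coord_p f x \<and> 0 \<le> coord_m f x \<and>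
                  (f \<notin> N \<longrightarrow> coord_p f x = 0 \<and> coord_m f x = 0)}"
  have "convex_cone ?C" unfolding convex_cone_iff by auto
  moreover have "basis_plus ` N \<union> basis_minus ` N \<subseteq> ?C" by auto
  ultimately have "orthant N \<subseteq> ?C" unfolding orthant_def by (simp add: hull_minimal)
  moreover have "x \<in> orthant N" if x: "x \<in> ?C"
  proof -
    have mem: "basis_plus f \<in> orthant N" "basis_minus f \<in> orthant N" if "f \<in> N" for f
      using that by (auto simp: orthant_def hull_inc)
    have cc: "convex_cone (orthant N)" by (simp add: orthant_def convex_cone_convex_cone_hull)
    have sums: "(\<Sum>f\<in>A. h f) \<in> orthant N" if "\<And>f. f \<in> A \<Longrightarrow> h f \<in> orthant N"
      for A :: "'a set" and h
      using that by (induction A rule: infinite_finite_induct)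
        (auto simp: convex_cone_contains_0[OF cc] convex_cone_add[OF cc])
    have "x = (\<Sum>f\<in>N. coord_p f x *\<^sub>R basis_plus f) + (\<Sum>f\<in>N. coord_m f x *\<^sub>R basis_minus f)"
      using x by (intro doubled_eqI) (auto simp: if_distrib of_bool_def cong: if_cong)
    also have "\<dots> \<in> orthant N"
      using x mem by (intro convex_cone_add[OF cc] sums convex_cone_scaleR[OF cc]) auto
    finally show ?thesis .
  qed
  ultimately show ?thesis by blast
qed

lemma orthant_mono: "M \<subseteq> N \<Longrightarrow> orthant M \<subseteq> orthant N"
  unfolding orthant_def by (intro hull_mono) auto

lemma orthant_subset_doubled_space: "orthant G \<subseteq> doubled_space G"
  unfolding orthant_def doubled_space_def
  by (simp add: convex_cone_span hull_minimal span_superset)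

text \<open>The mass present just above \<open>g\<close>. The index set varies, since the recursion over nested
  sets looks only at their own members.\<close>

definition budget :: "'a::{finite, order} set \<Rightarrow> 'a \<Rightarrow> 'a doubled \<Rightarrow> real" where
  "budget N g x = (\<Sum>f\<in>{f \<in> N. g < f}. coord_p f x - coord_m f x)"

lemma budget_linear [simp]:
  "budget N g 0 = 0" "budget N g (x + y) = budget N g x + budget N g y"
  "budget N g (c *\<^sub>R x) = c * budget N g x"
  by (auto simp: budget_def sum.distrib[symmetric] sum_distrib_left algebra_simps intro!: sum.cong)

lemma budget_restrict:
  assumes "x \<in> orthant N" "N \<subseteq> G"
  shows "budget G g x = budget N g x"
  unfolding budget_def using assms
  by (intro sum.mono_neutral_right) (auto simp: orthant_iff)

text \<open>When \<open>m\<close> vanishes at \<open>top\<close>, the separate summand \<open>coord_p top x\<close> of \<open>causal_form\<close> is just the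
  term \<open>f = top\<close> of the budget. At \<open>g = top\<close> the budget is an empty sum, so that the uniform
  inequality also encodes the equation \<open>coord_m top x = 0\<close>.\<close>

lemma causal_cone_budget:
  fixes G :: "'a::{finite, bounded_lattice} set"
  assumes top: "top \<in> G"
  shows "x \<in> causal_cone G \<longleftrightarrow> x \<in> doubled_space G \<and>
    (\<forall>g\<in>G. 0 \<le> coord_p g x \<and> 0 \<le> coord_m g x \<and> coord_m g x \<le> budget G g x)"
proof -
  have at_top: "budget G top x = 0" by (simp add: budget_def)
  have form: "causal_form G g x = budget G g x - coord_m g x"
    if "g \<noteq> top" "coord_m top x = 0" for g
  proof -
    have "{f \<in> G. g < f} = insert top {f \<in> G. g < f \<and> f < top}"
      using top that(1) by (auto simp: top.not_eq_extremum)
    then show ?thesis using that by (simp add: causal_form_def budget_def)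
  qed
  have form_top: "causal_form G top x = coord_p top x - coord_m top x"
    by (simp add: causal_form_def)
  show ?thesis
  proof
    assume x: "x \<in> causal_cone G"
    then have m0: "coord_m top x = 0" by (simp add: causal_cone_def)
    have "coord_m g x \<le> budget G g x" if "g \<in> G" for g
    proof (cases "g = top")
      case True then show ?thesis using m0 at_top by simp
    next
      case False
      then show ?thesis using form[OF False m0] x that by (auto simp: causal_cone_def)
    qed
    then show "x \<in> doubled_space G \<and>
      (\<forall>g\<in>G. 0 \<le> coord_p g x \<and> 0 \<le> coord_m g x \<and> coord_m g x \<le> budget G g x)"
      using x by (auto simp: causal_cone_def)
  next
    assume x: "x \<in> doubled_space G \<and>
      (\<forall>g\<in>G. 0 \<le> coord_p g x \<and> 0 \<le> coord_m g x \<and> coord_m g x \<le> budget G g x)"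
    then have m0: "coord_m top x = 0" using top at_top by fastforce
    have "0 \<le> causal_form G g x" if "g \<in> G" for g
    proof (cases "g = top")
      case True then show ?thesis using m0 form_top x top by simp
    next
      case False
      then show ?thesis using form[OF False m0] x that by auto
    qed
    then show "x \<in> causal_cone G" using x m0 by (auto simp: causal_cone_def)
  qed
qed

lemma convex_cone_causal_cone:
  fixes G :: "'a::{finite, bounded_lattice} set"
  assumes "top \<in> G"
  shows "convex_cone (causal_cone G)"
  unfolding convex_cone_iff
  by (auto simp: causal_cone_budget[OF assms] doubled_space_def span_zero span_add span_mul
      add_mono mult_left_mono)

lemma convex_cone_universe_cone:
  fixes G :: "'a::{finite, bounded_lattice} set"
  assumes "top \<in> G"
  shows "convex_cone (universe_cone G N)"
  using convex_cone_causal_cone[OF assms] convex_cone_convex_cone_hull[of "basis_plus ` N \<union> basis_minus ` N"]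
  by (auto simp: convex_cone_iff universe_cone_def orthant_def)

lemma universe_cone_iff:
  fixes G :: "'a::{finite, bounded_lattice} set"
  assumes "top \<in> G" "N \<subseteq> G"
  shows "x \<in> universe_cone G N \<longleftrightarrow>
    x \<in> orthant N \<and> (\<forall>g\<in>G. coord_m g x \<le> budget N g x)"
proof -
  have "orthant N \<subseteq> doubled_space G"
    using orthant_mono[OF assms(2)] orthant_subset_doubled_space by blast
  then show ?thesis
    unfolding universe_cone_def
    by (auto simp: causal_cone_budget[OF assms(1)] orthant_iff budget_restrict[OF _ assms(2)])
qed

section \<open>Nested sets and causal regions\<close>

lemma nested_subset: "nested G N \<Longrightarrow> M \<subseteq> N \<Longrightarrow> nested G M"
  unfolding nested_def by blast

lemma nestable_props:
  assumes "nestable G"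
  shows "top \<in> G" "g \<in> G \<Longrightarrow> bot < g"
  using assms by (auto simp: nestable_def)

text \<open>The forest property: two incomparable members of a nested set have a join outside \<open>G\<close>,
  hence meet \<open>bot\<close>, so they cannot both lie above \<open>g\<close>.\<close>

lemma nested_above_chain:
  assumes G: "nestable G" and N: "nested G N" and f: "f \<in> N" "f' \<in> N"
    and g: "bot < g" "g \<le> f" "g \<le> f'"
  shows "\<not> incomparable f f'"
proof
  assume inc: "incomparable f f'"
  then have "f \<noteq> f'" "incomparable f' f" by (auto simp: incomparable_def)
  then have "card {f, f'} = 2" "pairwise incomparable {f, f'}"
    using inc by (auto simp: pairwise_def)
  then have "Sup_fin {f, f'} \<notin> G"
    using N f unfolding nested_def by (metis empty_subsetI insert_subset order_refl)
  then have "sup f f' \<notin> G" by simp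
  moreover have "f \<in> G" "f' \<in> G" using N f by (auto simp: nested_def)
  ultimately have "inf f f' = bot" using G inc by (auto simp: nestable_def)
  then have "g \<le> bot" using g by (metis le_inf_iff)
  then show False using g(1) by simp
qed

text \<open>An element that is maximal in a finite set and unique as such lies above all others.\<close>

lemma causal_region_top:
  fixes R :: "'a::{finite, bounded_lattice} set"
  assumes "causal_region G R"
  shows "region_top R \<in> R" "r \<in> R \<Longrightarrow> r \<noteq> region_top R \<Longrightarrow> r < region_top R"
proof -
  have ex: "\<exists>!r. maximal_in R r" using assms by (simp add: causal_region_def)
  have max: "maximal_in R (region_top R)"
    unfolding region_top_def by (rule theI'[OF ex])
  then show "region_top R \<in> R" by (simp add: maximal_in_def)
  assume r: "r \<in> R" "r \<noteq> region_top R"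
  obtain s where s: "s \<in> R" "r \<le> s" "\<And>b. b \<in> R \<Longrightarrow> s \<le> b \<Longrightarrow> s = b"
    using finite_has_maximal2[of R r] r by (auto simp: finite)
  then have "maximal_in R s" by (auto simp: maximal_in_def less_le)
  then have "s = region_top R" using ex max by blast
  then show "r < region_top R" using s r by simp
qed

lemma causal_regionI:
  fixes S :: "'a::{finite, bounded_lattice} set"
  assumes "nested G (insert r S)" "\<And>s. s \<in> S \<Longrightarrow> s < r" "pairwise incomparable S"
  shows "causal_region G (insert r S)" "region_top (insert r S) = r"
proof -
  have max: "maximal_in (insert r S) s \<longleftrightarrow> s = r" for s
    using assms(2) by (auto simp: maximal_in_def dest: less_asym)
  then show t: "region_top (insert r S) = r" by (simp add: region_top_def)
  have "insert r S - {r} = S" using assms(2) by auto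
  then show "causal_region G (insert r S)"
    using assms max t by (simp add: causal_region_def)
qed

lemma causal_region_singleton:
  assumes "nested G N" "g \<in> N"
  shows "causal_region G {g}" "region_vector {g} = basis_plus g"
proof -
  have "nested G (insert g {})" using assms nested_subset by blast
  note * = causal_regionI[OF this]
  show "causal_region G {g}" by (rule *) auto
  have "region_top {g} = g" by (rule *) auto
  then show "region_vector {g} = basis_plus g" by (simp add: region_vector_def)
qed

lemma coord_region_vector [simp]:
  "coord_p f (region_vector R) = of_bool (f = region_top R)"
  "coord_m f (region_vector R) = of_bool (f \<in> R - {region_top R})"
  by (auto simp: region_vector_def of_bool_def)

lemma region_vector_in_orthant:
  assumes "causal_region G R" "R \<subseteq> N"
  shows "region_vector R \<in> orthant N"
  using causal_region_top(1)[OF assms(1)] assms(2) by (auto simp: orthant_iff)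

lemma region_vector_nonzero: "region_vector R \<noteq> 0"
proof
  assume "region_vector R = 0"
  then have "coord_p (region_top R) (region_vector R) = 0" by simp
  then show False by simp
qed

definition alive :: "'a::{finite, order} set \<Rightarrow> 'a \<Rightarrow> bool" where
  "alive R g \<longleftrightarrow> g < region_top R \<and> (\<forall>r\<in>R - {region_top R}. \<not> g < r)"

text \<open>By the forest property at most one of the incomparable \<open>r\<^sub>i\<close> is above \<open>g\<close>, so the
  particle is never destroyed twice on its way to \<open>g\<close>.\<close>

lemma budget_region_vector:
  fixes G :: "'a::{finite, bounded_lattice} set"
  assumes G: "nestable G" and R: "causal_region G R" "R \<subseteq> N" and g: "bot < g"
  shows "budget N g (region_vector R) = of_bool (alive R g)"
proof -
  let ?t = "region_top R" and ?S = "R - {region_top R}"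
  let ?K = "{r \<in> ?S. g < r}"
  have t: "?t \<in> N" using causal_region_top(1)[OF R(1)] R(2) by blast
  have "budget N g (region_vector R)
      = (\<Sum>f\<in>{f \<in> N. g < f}. of_bool (f = ?t)) - (\<Sum>f\<in>{f \<in> N. g < f}. of_bool (f \<in> ?S))"
    unfolding budget_def by (simp add: sum_subtractf)
  also have "(\<Sum>f\<in>{f \<in> N. g < f}. of_bool (f = ?t)) = (of_bool (g < ?t) :: real)"
    using t by (auto simp: of_bool_def)
  also have "(\<Sum>f\<in>{f \<in> N. g < f}. of_bool (f \<in> ?S)) = (\<Sum>f\<in>?K. 1 :: real)"
    using R(2) by (intro sum.mono_neutral_cong_right) auto
  also have "\<dots> = real (card ?K)" by simp
  finally have eq: "budget N g (region_vector R) = of_bool (g < ?t) - real (card ?K)" .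
  show ?thesis
  proof (cases "?K = {}")
    case True
    then have "card ?K = 0" by (simp only: card.empty)
    moreover have "alive R g \<longleftrightarrow> g < ?t" using True by (auto simp: alive_def)
    ultimately show ?thesis using eq by simp
  next
    case False
    then obtain r where r: "r \<in> ?K" by blast
    have nest: "nested G R" and anti: "pairwise incomparable ?S"
      using R(1) by (auto simp: causal_region_def)
    have "?K = {r}"
    proof -
      have "r' = r" if r': "r' \<in> ?K" for r'
      proof (rule ccontr)
        assume "r' \<noteq> r"
        then have "incomparable r' r" using anti r r' unfolding pairwise_def by blast
        moreover have "\<not> incomparable r' r"
          using r r' by (intro nested_above_chain[OF G nest _ _ g]) auto
        ultimately show False by blast
      qed
      then show ?thesis using r by blast
    qed
    then have "card ?K = 1" by simp
    moreover have "g < ?t" using r causal_region_top(2)[OF R(1)] by (blast intro: less_trans)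
    moreover have "\<not> alive R g" using r by (auto simp: alive_def)
    ultimately show ?thesis using eq by simp
  qed
qed

lemma region_vector_in_universe_cone:
  fixes G :: "'a::{finite, bounded_lattice} set"
  assumes G: "nestable G" and N: "nested G N" and R: "causal_region G R" "R \<subseteq> N"
  shows "region_vector R \<in> universe_cone G N"
proof -
  have NG: "N \<subseteq> G" using N by (simp add: nested_def)
  have "coord_m g (region_vector R) \<le> budget N g (region_vector R)" if g: "g \<in> G" for g
  proof -
    have "alive R g" if m: "g \<in> R - {region_top R}"
    proof -
      have "\<not> g < r" if "r \<in> R - {region_top R}" for r
        using R(1) m that unfolding causal_region_def pairwise_def incomparable_def
        by (metis less_imp_le order_less_irrefl)
      then show ?thesis using causal_region_top(2)[OF R(1)] m by (auto simp: alive_def)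
    qed
    then show ?thesis
      using budget_region_vector[OF G R nestable_props(2)[OF G g]] by auto
  qed
  then show ?thesis
    using universe_cone_iff[OF nestable_props(1)[OF G] NG] region_vector_in_orthant[OF R] by blast
qed

section \<open>Generation of the universe cones by causal regions\<close>

abbreviation region_cone :: "'a::{finite, bounded_lattice} set \<Rightarrow> 'a set \<Rightarrow> 'a doubled set" where
  "region_cone G N \<equiv> convex_cone hull {region_vector R | R. R \<subseteq> N \<and> causal_region G R}"

text \<open>Death at a minimal element \<open>g\<close> can be charged to the particles that arrive there. For a
  single region alive at \<open>g\<close> this replaces part of \<open>w\<^sub>R\<close> by \<open>w\<close> of \<open>R \<union> {g}\<close>. The property
  passes to sums by sharing the mass \<open>t\<close> between the summands, which needs the budgets of
  the summands to be nonnegative; this is why that is part of the induction.\<close>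

lemma absorb_death_at_minimal:
  fixes G :: "'a::{finite, bounded_lattice} set"
  assumes G: "nestable G" and N: "nested G N" and g: "g \<in> N" "\<And>f. f \<in> N \<Longrightarrow> \<not> f < g"
    and y: "y \<in> region_cone G (N - {g})" and t: "0 \<le> t" "t \<le> budget N g y"
  shows "y + t *\<^sub>R basis_minus g \<in> region_cone G N"
proof -
  let ?K = "region_cone G N"
  let ?T = "{y. 0 \<le> budget N g y \<and> (\<forall>t. 0 \<le> t \<longrightarrow> t \<le> budget N g y \<longrightarrow> y + t *\<^sub>R basis_minus g \<in> ?K)}"
  have gb: "bot < g" using N g nestable_props(2)[OF G] by (auto simp: nested_def)
  have "convex_cone ?T"
  proof (intro convex_cone_iff[THEN iffD2] conjI ballI allI impI)
    show "0 \<in> ?T" by (auto simp: convex_cone_hull_contains_0)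
  next
    fix a b assume a: "a \<in> ?T" and b: "b \<in> ?T"
    have "a + b + t *\<^sub>R basis_minus g \<in> ?K" if t: "0 \<le> t" "t \<le> budget N g (a + b)" for t
    proof -
      define s where "s = min t (budget N g a)"
      have "a + s *\<^sub>R basis_minus g \<in> ?K" using a t by (auto simp: s_def)
      moreover have "b + (t - s) *\<^sub>R basis_minus g \<in> ?K" using b t by (auto simp: s_def min_def)
      ultimately have "(a + s *\<^sub>R basis_minus g) + (b + (t - s) *\<^sub>R basis_minus g) \<in> ?K"
        by (rule convex_cone_hull_add)
      then show ?thesis by (simp add: algebra_simps)
    qed
    then show "a + b \<in> ?T" using a b by auto
  next
    fix a and c :: real assume a: "a \<in> ?T" and c: "0 \<le> c"
    have "c *\<^sub>R a + t *\<^sub>R basis_minus g \<in> ?K" if t: "0 \<le> t" "t \<le> budget N g (c *\<^sub>R a)" for t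
    proof (cases "c = 0")
      case True
      then show ?thesis using t by (simp add: convex_cone_hull_contains_0)
    next
      case False
      then have "t / c \<le> budget N g a" "0 \<le> t / c" using t c by (auto simp: field_simps)
      then have "c *\<^sub>R (a + (t / c) *\<^sub>R basis_minus g) \<in> ?K"
        using a c by (intro convex_cone_hull_mul) auto
      then show ?thesis using False by (simp add: scaleR_add_right)
    qed
    then show "c *\<^sub>R a \<in> ?T" using a c by auto
  qed
  moreover have "{region_vector R | R. R \<subseteq> N - {g} \<and> causal_region G R} \<subseteq> ?T"
  proof
    fix w assume "w \<in> {region_vector R | R. R \<subseteq> N - {g} \<and> causal_region G R}"
    then obtain R where wR: "w = region_vector R"
      and RN: "R \<subseteq> N - {g}" and R: "causal_region G R"
      by blast
    let ?t = "region_top R"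
    have R': "R \<subseteq> N" using RN by blast
    note bud = budget_region_vector[OF G R R' gb]
    have w: "region_vector R \<in> ?K" using R R' by (blast intro: hull_inc)
    have "region_vector R + t *\<^sub>R basis_minus g \<in> ?K"
      if t: "0 \<le> t" "t \<le> of_bool (alive R g)" for t
    proof (cases "alive R g")
      case False
      then have "t = 0" using t by simp
      then show ?thesis using w by simp
    next
      case True
      let ?S = "insert g (R - {?t})"
      have gR: "g \<notin> R" using RN by blast
      have ins: "insert ?t ?S = insert g R" using causal_region_top(1)[OF R] by auto
      have below: "s < ?t" if "s \<in> ?S" for s
        using that True causal_region_top(2)[OF R] by (auto simp: alive_def)
      have "incomparable r g \<and> incomparable g r" if "r \<in> R - {?t}" for r
      proof -
        have "\<not> g < r" "\<not> r < g" "r \<noteq> g"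
          using that True g(2) RN by (auto simp: alive_def)
        then show ?thesis by (auto simp: incomparable_def less_le)
      qed
      then have anti: "pairwise incomparable ?S"
        using R by (auto simp: causal_region_def pairwise_insert)
      have sub: "insert ?t ?S \<subseteq> N" using ins g(1) R' by simp
      have nest: "nested G (insert ?t ?S)" by (rule nested_subset[OF N sub])
      have reg: "causal_region G (insert g R)" and tp: "region_top (insert g R) = ?t"
        using causal_regionI[OF nest below anti] unfolding ins by auto
      have "g \<noteq> ?t" using True by (auto simp: alive_def)
      then have "region_vector (insert g R) = region_vector R + basis_minus g"
        using gR tp by (intro doubled_eqI) (auto simp: of_bool_def)
      moreover have "region_vector (insert g R) \<in> ?K"
        using reg ins sub by (intro hull_inc) auto
      ultimately have wg: "region_vector R + basis_minus g \<in> ?K" by simp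
      have "(1 - t) *\<^sub>R region_vector R + t *\<^sub>R (region_vector R + basis_minus g) \<in> ?K"
        using t True
        by (intro convex_cone_hull_add[OF convex_cone_hull_mul[OF w] convex_cone_hull_mul[OF wg]]) auto
      then show ?thesis by (simp add: algebra_simps)
    qed
    then show "w \<in> ?T" using bud wR by simp
  qed
  ultimately have "region_cone G (N - {g}) \<subseteq> ?T" by (simp add: hull_minimal)
  then show ?thesis using y t by blast
qed

text \<open>Restricting the inequalities to the members of \<open>N\<close> makes the induction work: the removed
  element \<open>g\<close> is minimal in \<open>N\<close>, so it contributes to no budget at another member, and all
  inequalities pass to \<open>N - {g}\<close> unchanged.\<close>

lemma in_region_coneI:
  fixes G :: "'a::{finite, bounded_lattice} set"
  assumes G: "nestable G" and N: "nested G N"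
    and x: "x \<in> orthant N" "\<And>g. g \<in> N \<Longrightarrow> coord_m g x \<le> budget N g x"
  shows "x \<in> region_cone G N"
  using finite[of N] N x
proof (induction N arbitrary: x rule: finite_psubset_induct)
  case (psubset N)
  show ?case
  proof (cases "N = {}")
    case True
    then have "x = 0" using psubset.prems(2) by (intro doubled_eqI) (auto simp: orthant_iff)
    then show ?thesis by (simp add: convex_cone_hull_contains_0)
  next
    case False
    obtain g where g: "g \<in> N" "\<And>f. f \<in> N \<Longrightarrow> \<not> f < g"
      using ex_min_if_finite[OF finite False] by blast
    define y where "y = x + (- coord_p g x) *\<^sub>R basis_plus g + (- coord_m g x) *\<^sub>R basis_minus g"
    have cy: "coord_p f y = (if f = g then 0 else coord_p f x)"
      "coord_m f y = (if f = g then 0 else coord_m f x)" for f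
      by (simp_all only: y_def coord_linear coord_basis, simp_all)
    have y: "y \<in> orthant (N - {g})" using psubset.prems(2) by (auto simp: orthant_iff cy)
    have sub: "nested G (N - {g})" using nested_subset[OF psubset.prems(1)] by blast
    have bud: "budget N f y = budget N f x" if "f \<in> N" for f
      unfolding budget_def using g(2)[OF that] by (intro sum.cong) (auto simp: cy)
    have "coord_m f y \<le> budget (N - {g}) f y" if f: "f \<in> N - {g}" for f
    proof -
      have "coord_m f y = coord_m f x" using f by (simp add: cy)
      also have "\<dots> \<le> budget N f x" using psubset.prems(3) f by blast
      also have "\<dots> = budget N f y" using bud f by simp
      also have "\<dots> = budget (N - {g}) f y" using budget_restrict[OF y] by blast
      finally show ?thesis .
    qed
    then have "y \<in> region_cone G (N - {g})"
      using psubset.IH[OF _ sub y] g(1) by blast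
    moreover have "0 \<le> coord_m g x" "0 \<le> coord_p g x"
      using psubset.prems(2) by (auto simp: orthant_iff)
    moreover have "coord_m g x \<le> budget N g y" using bud g(1) psubset.prems(3) by simp
    ultimately have "y + coord_m g x *\<^sub>R basis_minus g \<in> region_cone G N"
      by (intro absorb_death_at_minimal[OF G psubset.prems(1) g])
    moreover have "basis_plus g \<in> region_cone G N"
      using causal_region_singleton[OF psubset.prems(1) g(1)] g(1)
      by (intro hull_inc) (metis (mono_tags, lifting) empty_subsetI insert_subset mem_Collect_eq)
    ultimately have "(y + coord_m g x *\<^sub>R basis_minus g) + coord_p g x *\<^sub>R basis_plus g \<in> region_cone G N"
      using \<open>0 \<le> coord_p g x\<close> by (rule convex_cone_hull_add[OF _ convex_cone_hull_mul])
    then show ?thesis by (simp add: y_def)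
  qed
qed

lemma universe_cone_eq_region_cone:
  fixes G :: "'a::{finite, bounded_lattice} set"
  assumes G: "nestable G" and N: "nested G N"
  shows "universe_cone G N = region_cone G N"
proof
  have NG: "N \<subseteq> G" using N by (simp add: nested_def)
  note iff = universe_cone_iff[OF nestable_props(1)[OF G] NG]
  show "universe_cone G N \<subseteq> region_cone G N"
    using in_region_coneI[OF G N] NG unfolding iff subset_iff by blast
  show "region_cone G N \<subseteq> universe_cone G N"
    using region_vector_in_universe_cone[OF G N] convex_cone_universe_cone[OF nestable_props(1)[OF G]]
    by (intro hull_minimal) auto
qed

section \<open>Maximal cones and rays of the universe fan\<close>

text \<open>Cutting a face of an orthant with the causal cone yields a face of a universe cone, so
  the smaller cones of the doubled fan contribute nothing new.\<close>

lemma universe_fan_eq: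
  fixes G :: "'a::{finite, bounded_lattice} set"
  assumes "top \<in> G"
  shows "universe_fan G = (\<Union>N\<in>nested_complex G. cone_faces (universe_cone G N))"
proof
  have conv: "convex (causal_cone G)"
    using convex_cone_causal_cone[OF assms] by (simp add: convex_cone_def)
  show "universe_fan G \<subseteq> (\<Union>N\<in>nested_complex G. cone_faces (universe_cone G N))"
  proof
    fix X assume "X \<in> universe_fan G"
    then obtain N C where N: "N \<in> nested_complex G" "C face_of orthant N"
      "X face_of C \<inter> causal_cone G" "X \<noteq> {}"
      by (auto simp: universe_fan_def doubled_fan_def cone_faces_def)
    then have "X face_of universe_cone G N"
      unfolding universe_cone_def using face_of_slice[OF _ conv] face_of_trans by blast
    then show "X \<in> (\<Union>N\<in>nested_complex G. cone_faces (universe_cone G N))"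
      using N by (auto simp: cone_faces_def)
  qed
  have "orthant N \<in> cone_faces (orthant N)" for N :: "'a set"
    by (auto simp: cone_faces_def orthant_def convex_cone_hull_nonempty
        intro!: face_of_refl convex_convex_cone_hull)
  then show "(\<Union>N\<in>nested_complex G. cone_faces (universe_cone G N)) \<subseteq> universe_fan G"
    unfolding universe_fan_def doubled_fan_def universe_cone_def by blast
qed

lemma universe_cone_in_universe_fan:
  fixes G :: "'a::{finite, bounded_lattice} set"
  assumes "top \<in> G" "N \<in> nested_complex G"
  shows "universe_cone G N \<in> universe_fan G"
proof -
  have "convex_cone (universe_cone G N)" by (rule convex_cone_universe_cone[OF assms(1)])
  then have "universe_cone G N \<in> cone_faces (universe_cone G N)"
    by (auto simp: cone_faces_def convex_cone_def face_of_refl)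
  then show ?thesis using assms universe_fan_eq by blast
qed

lemma universe_cone_subset_imp_subset:
  fixes G :: "'a::{finite, bounded_lattice} set"
  assumes G: "nestable G" and N: "nested G N" and sub: "universe_cone G N \<subseteq> orthant M"
  shows "N \<subseteq> M"
proof
  fix f assume f: "f \<in> N"
  have "region_vector {f} \<in> universe_cone G N"
    using f causal_region_singleton(1)[OF N f] by (intro region_vector_in_universe_cone[OF G N]) auto
  then have "basis_plus f \<in> orthant M"
    using causal_region_singleton(2)[OF N f] sub by auto
  then have "f \<notin> M \<Longrightarrow> coord_p f (basis_plus f) = 0" unfolding orthant_iff by blast
  then show "f \<in> M" by auto
qed

lemma maximal_members_above:
  assumes "finite K" "N \<in> K"
  shows "\<exists>M\<in>maximal_members K. N \<subseteq> M"
  using finite_has_maximal2[OF assms] by (auto simp: maximal_members_def)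

lemma maximal_members_universe_fan:
  fixes G :: "'a::{finite, bounded_lattice} set"
  assumes G: "nestable G"
  shows "maximal_members (universe_fan G) = universe_cone G ` maximal_members (nested_complex G)"
proof -
  note fan = universe_fan_eq[OF nestable_props(1)[OF G]]
  have below: "\<exists>M\<in>maximal_members (nested_complex G). X \<subseteq> universe_cone G M"
    if X: "X \<in> universe_fan G" for X
  proof -
    obtain N where N: "N \<in> nested_complex G" "X \<subseteq> universe_cone G N"
      using X unfolding fan cone_faces_def by (auto dest: face_of_imp_subset)
    obtain M where "M \<in> maximal_members (nested_complex G)" "N \<subseteq> M"
      using maximal_members_above[OF _ N(1)] by (auto simp: finite)
    then show ?thesis using N(2) orthant_mono[of N M] by (auto simp: universe_cone_def)
  qed
  have mem: "universe_cone G M \<in> universe_fan G" if "M \<in> maximal_members (nested_complex G)" for M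
    using that universe_cone_in_universe_fan[OF nestable_props(1)[OF G]]
    by (auto simp: maximal_members_def)
  show ?thesis
  proof
    show "maximal_members (universe_fan G) \<subseteq> universe_cone G ` maximal_members (nested_complex G)"
    proof
      fix X assume X: "X \<in> maximal_members (universe_fan G)"
      then obtain M where "M \<in> maximal_members (nested_complex G)" "X \<subseteq> universe_cone G M"
        using below unfolding maximal_members_def[of "universe_fan G"] by blast
      then show "X \<in> universe_cone G ` maximal_members (nested_complex G)"
        using X mem unfolding maximal_members_def[of "universe_fan G"] by blast
    qed
  next
    show "universe_cone G ` maximal_members (nested_complex G) \<subseteq> maximal_members (universe_fan G)"
    proof clarify
      fix M assume M: "M \<in> maximal_members (nested_complex G)"
      have "X = universe_cone G M" if X: "X \<in> universe_fan G" "universe_cone G M \<subseteq> X" for X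
      proof -
        obtain M' where M': "M' \<in> maximal_members (nested_complex G)" "X \<subseteq> universe_cone G M'"
          using below X(1) by blast
        have "nested G M" using M by (simp add: maximal_members_def nested_complex_def)
        moreover have "universe_cone G M \<subseteq> orthant M'"
          using X(2) M'(2) by (auto simp: universe_cone_def)
        ultimately have "M \<subseteq> M'" by (rule universe_cone_subset_imp_subset[OF G])
        then have "M' = M" using M M'(1) by (auto simp: maximal_members_def)
        then show ?thesis using M'(2) X(2) by blast
      qed
      then show "universe_cone G M \<in> maximal_members (universe_fan G)"
        using mem[OF M] by (auto simp: maximal_members_def)
    qed
  qed
qed

text \<open>The supporting functional is the sum over the \<open>r\<^sub>i\<close> of what is born at \<open>r\<^sub>i\<close> and of what
  arrives at \<open>r\<^sub>i\<close> without dying. Only \<open>r\<^sub>*\<close> lies above an \<open>r\<^sub>i\<close> inside \<open>R\<close> and nothing lies above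
  \<open>r\<^sub>*\<close>, so where the functional vanishes, \<open>m\<close> at every \<open>r\<^sub>i\<close> equals \<open>p\<close> at \<open>r\<^sub>*\<close>.\<close>

lemma region_ray_face_of:
  fixes G :: "'a::{finite, bounded_lattice} set"
  assumes G: "nestable G" and R: "causal_region G R"
  shows "convex_cone hull {region_vector R} face_of universe_cone G R"
proof -
  let ?t = "region_top R" and ?S = "R - {region_top R}"
  define h where "h x = (\<Sum>r\<in>?S. coord_p r x + (budget R r x - coord_m r x))" for x
  have N: "nested G R" and anti: "pairwise incomparable ?S"
    using R by (auto simp: causal_region_def)
  have RG: "R \<subseteq> G" using N by (simp add: nested_def)
  have tR: "?t \<in> R" and lt: "\<And>s. s \<in> ?S \<Longrightarrow> s < ?t" using causal_region_top[OF R] by auto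
  note iff = universe_cone_iff[OF nestable_props(1)[OF G] RG]
  have lin: "linear h"
    by (rule linearI) (auto simp: h_def sum.distrib[symmetric] sum_distrib_left algebra_simps
        intro!: sum.cong)
  have summand: "0 \<le> coord_p r x + (budget R r x - coord_m r x)"
    if "x \<in> universe_cone G R" "r \<in> ?S" for x r
    using that RG unfolding iff orthant_iff by (auto simp: add_nonneg_nonneg)
  have above_t: "{f \<in> R. ?t < f} = {}" using lt by (auto dest: less_asym)
  have above_r: "{f \<in> R. r < f} = {?t}" if r: "r \<in> ?S" for r
  proof -
    have "\<not> r < f" if "f \<in> ?S" for f
      using anti r that unfolding pairwise_def incomparable_def
      by (metis less_imp_le order_less_irrefl)
    then show ?thesis using tR lt[OF r] by auto
  qed
  have "convex_cone hull {region_vector R} = {x \<in> universe_cone G R. h x = 0}"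
  proof
    have "h (region_vector R) = 0"
      unfolding h_def by (intro sum.neutral ballI) (auto simp: budget_def above_r tR)
    moreover have "region_vector R \<in> universe_cone G R"
      by (rule region_vector_in_universe_cone[OF G N R order_refl])
    ultimately show "convex_cone hull {region_vector R} \<subseteq> {x \<in> universe_cone G R. h x = 0}"
      using convex_cone_scaleR[OF convex_cone_universe_cone[OF nestable_props(1)[OF G], of R], of _ "region_vector R"]
      by (auto simp: convex_cone_hull_singleton linear_cmul[OF lin])
  next
    show "{x \<in> universe_cone G R. h x = 0} \<subseteq> convex_cone hull {region_vector R}"
    proof clarify
      fix x assume x: "x \<in> universe_cone G R" "h x = 0"
      then have orth: "x \<in> orthant R" and ineq: "\<And>g. g \<in> G \<Longrightarrow> coord_m g x \<le> budget R g x"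
        unfolding iff by auto
      have nonneg: "0 \<le> coord_p f x" "0 \<le> coord_m f x" for f
        using orth by (auto simp: orthant_iff)
      have "coord_m ?t x \<le> 0" using ineq[of ?t] RG tR by (auto simp: budget_def above_t)
      then have mt: "coord_m ?t x = 0" using nonneg(2)[of ?t] by linarith
      have r: "coord_p r x = 0 \<and> coord_m r x = coord_p ?t x" if r: "r \<in> ?S" for r
      proof -
        have "\<forall>r\<in>?S. coord_p r x + (budget R r x - coord_m r x) = 0"
          using x(2) summand[OF x(1)] unfolding h_def by (subst (asm) sum_nonneg_eq_0_iff) auto
        then have "coord_p r x + (budget R r x - coord_m r x) = 0" using r by blast
        moreover have "coord_m r x \<le> budget R r x" using ineq r RG by blast
        moreover have "budget R r x = coord_p ?t x" using above_r[OF r] mt by (simp add: budget_def)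
        ultimately show ?thesis using nonneg(1)[of r] by linarith
      qed
      have "x = coord_p ?t x *\<^sub>R region_vector R"
      proof (rule doubled_eqI)
        fix f
        show "coord_p f x = coord_p f (coord_p ?t x *\<^sub>R region_vector R)"
          using r[of f] orth by (cases "f \<in> R") (auto simp: orthant_iff tR)
        show "coord_m f x = coord_m f (coord_p ?t x *\<^sub>R region_vector R)"
          using r[of f] mt orth by (cases "f \<in> R") (auto simp: orthant_iff)
      qed
      then show "x \<in> convex_cone hull {region_vector R}"
        using nonneg(1) by (auto simp: convex_cone_hull_singleton)
    qed
  qed
  moreover have "{x \<in> universe_cone G R. h x = 0} face_of universe_cone G R"
  proof (rule linear_zero_set_face_of[OF _ lin])
    show "convex (universe_cone G R)"
      using convex_cone_universe_cone[OF nestable_props(1)[OF G]] by (simp add: convex_cone_def)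
    show "0 \<le> h x" if "x \<in> universe_cone G R" for x
      unfolding h_def using summand[OF that] by (rule sum_nonneg)
  qed
  ultimately show ?thesis by simp
qed

lemma fan_rays_universe_fan:
  fixes G :: "'a::{finite, bounded_lattice} set"
  assumes G: "nestable G"
  shows "fan_rays (universe_fan G) = {convex_cone hull {region_vector R} | R. causal_region G R}"
proof
  note fan = universe_fan_eq[OF nestable_props(1)[OF G]]
  show "{convex_cone hull {region_vector R} | R. causal_region G R} \<subseteq> fan_rays (universe_fan G)"
  proof clarify
    fix R assume R: "causal_region G R"
    then have "R \<in> nested_complex G" by (simp add: causal_region_def nested_complex_def)
    then have "convex_cone hull {region_vector R} \<in> universe_fan G"
      unfolding fan using region_ray_face_of[OF G R]
      by (auto simp: cone_faces_def convex_cone_hull_nonempty)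
    then show "convex_cone hull {region_vector R} \<in> fan_rays (universe_fan G)"
      by (simp add: fan_rays_def dim_convex_cone_hull_singleton region_vector_nonzero)
  qed
  show "fan_rays (universe_fan G) \<subseteq> {convex_cone hull {region_vector R} | R. causal_region G R}"
  proof
    fix X assume "X \<in> fan_rays (universe_fan G)"
    then obtain N where dim: "dim X = 1" and N: "nested G N" and X: "X face_of universe_cone G N"
      unfolding fan fan_rays_def by (auto simp: cone_faces_def nested_complex_def)
    note face = X[unfolded universe_cone_eq_region_cone[OF G N]]
    have "\<not> X \<subseteq> {0}" using dim dim_eq_0[of X] by simp
    then obtain x where "x \<in> X" "x \<noteq> 0" by blast
    then obtain R where R: "causal_region G R" "R \<subseteq> N" "region_vector R \<in> X"
      using face_contains_generator[OF face] by blast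
    let ?w = "region_vector R"
    have con: "conic X" using face face_of_conic conic_convex_cone_hull by blast
    have "dim {?w} = 1" by (simp add: dim_insert region_vector_nonzero)
    then have "span {?w} = span X" using R(3) dim by (intro dim_eq_span) auto
    then have line: "X \<subseteq> span {?w}" using span_superset by blast
    have "X = convex_cone hull {?w}"
    proof
      show "X \<subseteq> convex_cone hull {?w}"
      proof
        fix x assume x: "x \<in> X"
        then obtain c where c: "x = c *\<^sub>R ?w" using line by (auto simp: span_singleton)
        have "x \<in> orthant N" using x X face_of_imp_subset by (auto simp: universe_cone_def)
        (* The coordinate at the top of R tells the ray from its opposite. *)
        then have "0 \<le> coord_p (region_top R) x" by (simp add: orthant_iff)
        then have "0 \<le> c" using c by simp
        then show "x \<in> convex_cone hull {?w}" using c by (auto simp: convex_cone_hull_singleton)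
      qed
      show "convex_cone hull {?w} \<subseteq> X"
        using R(3) con by (auto simp: convex_cone_hull_singleton conic_mul)
    qed
    then show "X \<in> {convex_cone hull {region_vector R} | R. causal_region G R}"
      using R(1) by blast
  qed
qed

theorem theorem3p6:
  fixes G :: "'a::{finite, bounded_lattice} set"
  assumes "nestoid G"
  shows "fan_rays (universe_fan G) =
           {convex_cone hull {region_vector R} | R. causal_region G R} \<and>
         maximal_members (universe_fan G) =
           universe_cone G ` maximal_members (nested_complex G) \<and>
         (\<forall>N \<in> maximal_members (nested_complex G).
            universe_cone G N =
              convex_cone hull {region_vector R | R. R \<subseteq> N \<and> causal_region G R})"
proof -
  have G: "nestable G" using assms by (simp add: nestoid_def)
  show ?thesis
    using fan_rays_universe_fan[OF G] maximal_members_universe_fan[OF G]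
      universe_cone_eq_region_cone[OF G]
    by (simp add: maximal_members_def nested_complex_def)
qed

end
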